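(* There is a function $\varepsilon:\mathbb{Z}_{>0}\to\mathbb{R}$ with $\varepsilon(r)\to 0$ as $r\to\infty$ such that for every positive integer $r$ there exists $n_0=n_0(r)$ such that for all $n\ge n_0$ the $r$-color size Ramsey number of the path $P_n$ satisfies $$\hat{R}(P_n,r)\le r^{2+\varepsilon(r)}\,n.$$
   Context: $P_n$ is the path on $n$ vertices. For graphs $G,H$ and a positive integer $r$, write $G\rightarrow (H)_r$ if every $r$-coloring of the edges of $G$ produces a monochromatic copy of $H$ (as a not necessarily induced subgraph). The $r$-color size Ramsey number $\hat{R}(H,r)$ is the minimum possible number of edges in a graph $G$ for which $G\rightarrow (H)_r$. *)

theory Defs
  imports Complex_Main "HOL-Library.Ramsey"
begin

type_synonym 'a graph = "'a set \<times> 'a set set"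

abbreviation gverts :: "'a graph \<Rightarrow> 'a set" where
  "gverts G \<equiv> fst G"

abbreviation gedges :: "'a graph \<Rightarrow> 'a set set" where
  "gedges G \<equiv> snd G"

definition simple_graph :: "'a graph \<Rightarrow> bool" where
  "simple_graph G \<longleftrightarrow>
     finite (gverts G) \<and> (\<forall>e\<in>gedges G. e \<subseteq> gverts G \<and> card e = 2)"

definition path_graph :: "nat \<Rightarrow> nat graph" where
  "path_graph n = ({..<n}, {{i, Suc i} | i. Suc i < n})"

text \<open>Copies are subgraphs that need not be induced, so non-edges of \<open>H\<close> are unconstrained.\<close>

definition contains_copy :: "'a graph \<Rightarrow> 'b graph \<Rightarrow> bool" where
  "contains_copy G H \<longleftrightarrow>
     (\<exists>f. inj_on f (gverts H) \<and> f ` gverts H \<subseteq> gverts G \<and>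
          (\<forall>e\<in>gedges H. f ` e \<in> gedges G))"

definition color_class :: "'a graph \<Rightarrow> ('a set \<Rightarrow> nat) \<Rightarrow> nat \<Rightarrow> 'a graph" where
  "color_class G c i = (gverts G, {e \<in> gedges G. c e = i})"

definition ramsey_arrow :: "'a graph \<Rightarrow> 'b graph \<Rightarrow> nat \<Rightarrow> bool" where
  "ramsey_arrow G H r \<longleftrightarrow>
     (\<forall>c. c \<in> gedges G \<rightarrow> {..<r} \<longrightarrow> (\<exists>i<r. contains_copy (color_class G c i) H))"

text \<open>Every finite graph is isomorphic to one whose vertices are natural numbers, so
  restricting the vertex type of \<open>G\<close> to \<^typ>\<open>nat\<close> does not change the minimum. The set
  being minimised over is nonempty by Ramsey's theorem; see \<open>size_ramsey_attained\<close>.\<close>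

definition size_ramsey :: "'a graph \<Rightarrow> nat \<Rightarrow> nat" where
  "size_ramsey H r =
     (LEAST m. \<exists>G :: nat graph. simple_graph G \<and> card (gedges G) = m \<and> ramsey_arrow G H r)"

lemma simple_graph_path_graph: "simple_graph (path_graph n)"
  by (auto simp: simple_graph_def path_graph_def)

lemma size_ramsey_attained:
  fixes H :: "'a graph"
  assumes "simple_graph H"
  shows "\<exists>G :: nat graph. simple_graph G \<and> card (gedges G) = size_ramsey H r \<and> ramsey_arrow G H r"
proof -
  let ?m = "card (gverts H)"
  obtain N :: nat where N: "partn_lst {..<N} (replicate r ?m) 2"
    using ramsey_full by blast
  define G :: "nat graph" where "G = ({..<N}, [{..<N}]\<^bsup>2\<^esup>)"
  have "simple_graph G"
    by (auto simp: G_def simple_graph_def nsets_def)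
  moreover have "ramsey_arrow G H r"
    unfolding ramsey_arrow_def
  proof (intro allI impI)
    fix c assume "c \<in> gedges G \<rightarrow> {..<r}"
    then have c: "c \<in> [{..<N}]\<^bsup>2\<^esup> \<rightarrow> {..<r}"
      by (simp add: G_def)
    obtain i K where i: "i < r" and K: "K \<in> [{..<N}]\<^bsup>(replicate r ?m ! i)\<^esup>"
      and mono: "c ` ([K]\<^bsup>2\<^esup>) \<subseteq> {i}"
      using partn_lstE[OF N c] by auto
    have Km: "K \<subseteq> {..<N}" "finite K" "card K = ?m"
      using K i by (auto simp: nsets_def)
    then obtain f where f: "bij_betw f (gverts H) K"
      using assms finite_same_card_bij[of "gverts H" K] by (auto simp: simple_graph_def)
    have "f ` e \<in> gedges (color_class G c i)" if "e \<in> gedges H" for e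
    proof -
      have e: "e \<subseteq> gverts H" "card e = 2"
        using assms that by (auto simp: simple_graph_def)
      then have "inj_on f e"
        using f by (meson bij_betw_imp_inj_on inj_on_subset)
      moreover have "f ` e \<subseteq> K"
        using e f by (auto simp: bij_betw_def)
      ultimately have fe: "f ` e \<in> [K]\<^bsup>2\<^esup>"
        using e Km by (auto simp: nsets_def card_image finite_subset)
      then have "c (f ` e) = i"
        using mono by blast
      moreover have "f ` e \<in> [{..<N}]\<^bsup>2\<^esup>"
        using fe Km nsets_mono by blast
      ultimately show ?thesis
        by (simp add: color_class_def G_def)
    qed
    then have "contains_copy (color_class G c i) H"
      unfolding contains_copy_def
      using f Km by (intro exI[of _ f]) (auto simp: bij_betw_def color_class_def G_def)
    with i show "\<exists>i<r. contains_copy (color_class G c i) H"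
      by blast
  qed
  ultimately have "\<exists>m. \<exists>G :: nat graph. simple_graph G \<and> card (gedges G) = m \<and> ramsey_arrow G H r"
    by blast
  then show ?thesis
    unfolding size_ramsey_def by (rule LeastI_ex)
qed

end

theory Submission
  imports Defs "HOL-Real_Asymp.Real_Asymp"
begin

text \<open>
  The bound actually obtained is of order \<open>r\<^sup>2 log r \<cdot> n\<close>, and the logarithm disappears into
  \<open>r\<close> to the power \<open>\<epsilon> r\<close>. The host graph is a random graph on \<open>N = 24 r n\<close> vertices.

  A graph without a path on \<open>n\<close> vertices has few edges as soon as it is locally sparse.
  Depth-first search, stopped when exactly \<open>n\<close> vertices have been finished, produces a set \<open>S\<close> of
  \<open>n\<close> finished vertices all of whose outside neighbours lie on the current search path, which has
  fewer than \<open>n\<close> vertices. All edges meeting \<open>S\<close> therefore live on fewer than \<open>2 n\<close> vertices.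
  Deleting \<open>S\<close> and repeating, a graph on \<open>b n\<close> vertices whose sets of at most \<open>2 n\<close> vertices span at
  most \<open>K\<close> edges each has at most \<open>b K\<close> edges (\<open>card_edges_le_if_no_path\<close>). Consequently a graph
  with more than \<open>r b K\<close> edges has a monochromatic path in every \<open>r\<close>-colouring, because
  some colour class exceeds the bound (\<open>ramsey_arrow_path_if_locally_sparse\<close>).

  With \<open>b = 24 r\<close> a set of \<open>2 n\<close> vertices is expected to span a fraction of about
  \<open>(2 / b)\<^sup>2\<close> of the edges, while a fraction \<open>1 / (r b)\<close> is permitted, which is larger by the
  factor \<open>b / (4 r) = 6\<close>. This factor beats the constant 3 in the estimate
  \<open>(m choose t) \<le> (3 m / t)\<^sup>t\<close>, and what remains is a failure probability of at most
  \<open>2\<^sup>-\<^sup>t\<close> per set, where \<open>t\<close> is the forbidden number of edges. There are at most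
  \<open>(36 r)\<close> to the power \<open>2 n\<close> sets, so \<open>t = s n\<close> with \<open>2\<^sup>s > (36 r)\<^sup>2\<close> suffices for a union bound
  (\<open>ex_locally_sparse_graph\<close>). The graph then has \<open>r b t = 24 r\<^sup>2 s n\<close> edges, where \<open>s\<close> grows like
  \<open>log r\<close>. Only \<open>r = 1\<close>, where the power of \<open>r\<close> leaves no room for a constant, needs
  a separate host graph: the path itself.
\<close>

section \<open>Graphs without a long path\<close>

text \<open>
  The state of a depth-first search: \<open>S\<close> is the set of finished vertices and \<open>xs\<close> the current
  path, with its most recent vertex first. No edge joins a finished vertex to an unvisited one.
  Since vertices are finished one at a time, every value of \<open>card S\<close> occurs.
\<close>
lemma depth_first_partition:
  fixes V :: "'a set" and F :: "'a set set"
  assumes "finite V" "k \<le> card V"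
  shows "\<exists>S xs. S \<subseteq> V \<and> card S = k \<and> distinct xs \<and> set xs \<subseteq> V - S \<and>
           successively (\<lambda>u v. {u, v} \<in> F) xs \<and>
           (\<forall>u\<in>S. \<forall>v\<in>V - S - set xs. {u, v} \<notin> F)"
  using assms(2)
proof (induction k)
  case 0
  show ?case
    by (intro exI[of _ "{}"] exI[of _ "[]"]) auto
next
  case (Suc k)
  \<comment> \<open>Among the states with \<open>k\<close> finished vertices, one with a longest path cannot be extended at
    its head, so that its head can be finished next.\<close>
  define state where "state S xs \<longleftrightarrow> S \<subseteq> V \<and> card S = k \<and> distinct xs \<and> set xs \<subseteq> V - S \<and>
           successively (\<lambda>u v. {u, v} \<in> F) xs \<and>
           (\<forall>u\<in>S. \<forall>v\<in>V - S - set xs. {u, v} \<notin> F)" for S xs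
  have "\<exists>l S xs. state S xs \<and> length xs = l"
    using Suc by (auto simp: state_def)
  moreover have "l \<le> card V" if ex: "\<exists>S xs. state S xs \<and> length xs = l" for l
  proof -
    obtain S xs where "state S xs" "length xs = l" using ex by blast
    then have "distinct xs" "set xs \<subseteq> V" by (auto simp: state_def)
    then have "length xs \<le> card V"
      using card_mono[OF assms(1)] distinct_card by metis
    then show ?thesis using \<open>length xs = l\<close> by simp
  qed
  ultimately obtain l where l: "\<exists>S xs. state S xs \<and> length xs = l"
    and l_max: "\<And>l'. \<exists>S xs. state S xs \<and> length xs = l' \<Longrightarrow> l' \<le> l"
    using Nat.ex_has_greatest_nat[of "\<lambda>l. \<exists>S xs. state S xs \<and> length xs = l" _ "card V"]
    by (metis (mono_tags, lifting))
  from l obtain S xs where st: "state S xs" and len: "length xs = l"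
    by blast
  have maximal: "length ys \<le> length xs" if "state S ys" for ys
    using l_max[of "length ys"] that len by blast
  have finS: "finite S" using st assms(1) finite_subset by (auto simp: state_def)
  show ?case
  proof (cases xs)
    case Nil
    have "S \<noteq> V" using st Suc.prems by (auto simp: state_def)
    then obtain v where "v \<in> V - S" using st by (auto simp: state_def)
    then have "state S [v]"
      using st Nil by (auto simp: state_def)
    with maximal Nil show ?thesis by fastforce
  next
    case (Cons x ys)
    have no_nbr: "{x, v} \<notin> F" if "v \<in> V - S - set xs" for v
    proof
      assume "{x, v} \<in> F"
      then have "state S (v # xs)"
        using st Cons that by (auto simp: state_def insert_commute)
      with maximal show False by fastforce
    qed
    have "insert x S \<subseteq> V" "card (insert x S) = Suc k" "distinct ys" "set ys \<subseteq> V - insert x S"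
      "successively (\<lambda>u v. {u, v} \<in> F) ys"
      using st Cons finS by (auto simp: state_def successively_Cons)
    moreover have "{u, v} \<notin> F" if "u \<in> insert x S" "v \<in> V - insert x S - set ys" for u v
      using that no_nbr[of v] st Cons by (auto simp: state_def)
    ultimately show ?thesis by blast
  qed
qed

text \<open>
  Each round of the induction removes a set \<open>S\<close> of \<open>n\<close> vertices supplied by the depth-first search.
  The edges meeting \<open>S\<close> are confined to \<open>S\<close> and the search path, hence number at most \<open>K\<close>, and the
  other edges avoid \<open>S\<close>.
\<close>
lemma card_edges_le_if_no_path:
  fixes V :: "'a set" and F :: "'a set set"
  assumes "finite V" "card V = b * n" "\<And>e. e \<in> F \<Longrightarrow> e \<subseteq> V \<and> card e = 2"
    and no_path: "\<And>xs. distinct xs \<Longrightarrow> set xs \<subseteq> V \<Longrightarrow>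
                    successively (\<lambda>u v. {u, v} \<in> F) xs \<Longrightarrow> length xs < n"
    and sparse: "\<And>W. W \<subseteq> V \<Longrightarrow> card W \<le> 2 * n \<Longrightarrow> card {e \<in> F. e \<subseteq> W} \<le> K"
  shows "card F \<le> b * K"
  using assms
proof (induction b arbitrary: V F)
  case 0
  then have "F = {}" by fastforce
  then show ?case by simp
next
  case (Suc b)
  have "n \<le> card V" using Suc.prems by simp
  from depth_first_partition[OF Suc.prems(1) this, of F] obtain S xs where S: "S \<subseteq> V" "card S = n"
    and xs: "distinct xs" "set xs \<subseteq> V - S" "successively (\<lambda>u v. {u, v} \<in> F) xs"
    and sep: "\<And>u v. u \<in> S \<Longrightarrow> v \<in> V - S - set xs \<Longrightarrow> {u, v} \<notin> F"
    by blast
  define W where "W = S \<union> set xs"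
  define F' where "F' = {e \<in> F. e \<subseteq> V - S}"
  have "finite F"
    using Suc.prems(1,3) by (meson PowI finite_Pow_iff finite_subset subsetI)
  have "length xs < n" using Suc.prems(4)[of xs] xs by auto
  then have "card W \<le> 2 * n"
    unfolding W_def using S(2) xs(1) card_Un_le[of S "set xs"] by (simp add: distinct_card)
  moreover have "W \<subseteq> V" using S xs by (auto simp: W_def)
  ultimately have near: "card {e \<in> F. e \<subseteq> W} \<le> K"
    using Suc.prems(5) by blast
  have far: "card F' \<le> b * K"
  proof (rule Suc.IH)
    show "finite (V - S)" using Suc.prems by simp
    show "card (V - S) = b * n"
      using Suc.prems S by (simp add: card_Diff_subset finite_subset)
    show "e \<subseteq> V - S \<and> card e = 2" if "e \<in> F'" for e
      using that Suc.prems(3) by (auto simp: F'_def)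
    show "length ys < n" if "distinct ys" "set ys \<subseteq> V - S" "successively (\<lambda>u v. {u, v} \<in> F') ys" for ys
    proof (rule Suc.prems(4))
      show "successively (\<lambda>u v. {u, v} \<in> F) ys"
        using that(3) by (rule successively_mono) (auto simp: F'_def)
    qed (use that in auto)
    show "card {e \<in> F'. e \<subseteq> U} \<le> K" if "U \<subseteq> V - S" "card U \<le> 2 * n" for U
    proof -
      have "card {e \<in> F'. e \<subseteq> U} \<le> card {e \<in> F. e \<subseteq> U}"
        using \<open>finite F\<close> by (intro card_mono) (auto simp: F'_def)
      also have "\<dots> \<le> K" using that by (intro Suc.prems(5)) auto
      finally show ?thesis .
    qed
  qed
  have "F \<subseteq> F' \<union> {e \<in> F. e \<subseteq> W}"
  proof
    fix e assume e: "e \<in> F"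
    then have eV: "e \<subseteq> V" "card e = 2" using Suc.prems(3) by auto
    show "e \<in> F' \<union> {e \<in> F. e \<subseteq> W}"
    proof (cases "e \<inter> S = {}")
      case True
      then show ?thesis using e eV by (auto simp: F'_def)
    next
      case False
      then obtain u where u: "u \<in> e" "u \<in> S" by blast
      obtain v where v: "e = {u, v}"
        using eV(2) u(1) by (auto simp: card_2_iff)
      then have "v \<in> W"
        using sep[OF u(2), of v] e eV by (auto simp: W_def)
      then show ?thesis using e u v by (auto simp: W_def)
    qed
  qed
  then have "card F \<le> card (F' \<union> {e \<in> F. e \<subseteq> W})"
    using \<open>finite F\<close> by (intro card_mono) (auto simp: F'_def)
  also have "\<dots> \<le> card F' + card {e \<in> F. e \<subseteq> W}" by (rule card_Un_le)
  finally show ?case using near far by simp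
qed

section \<open>Sparse random subsets\<close>

lemma card_supersets:
  assumes "finite X" "T \<subseteq> X" "card T \<le> m"
  shows "card {E. T \<subseteq> E \<and> E \<subseteq> X \<and> card E = m} = (card X - card T) choose (m - card T)"
proof -
  have finT: "finite T" using assms finite_subset by blast
  have "bij_betw (\<lambda>E. E \<union> T) {E. E \<subseteq> X - T \<and> card E = m - card T}
          {E. T \<subseteq> E \<and> E \<subseteq> X \<and> card E = m}"
  proof (rule bij_betw_byWitness[where f' = "\<lambda>E. E - T"], goal_cases)
    case 3
    have "card (E \<union> T) = m" if "E \<subseteq> X - T" "card E = m - card T" for E
    proof -
      have "finite E" using that assms by (meson finite_Diff finite_subset)
      then have "card (E \<union> T) = card E + card T"
        using that finT by (intro card_Un_disjoint) auto
      then show ?thesis using that assms by simp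
    qed
    then show ?case using assms by auto
  next
    case 4
    show ?case using finT by (auto simp: card_Diff_subset)
  qed auto
  from bij_betw_same_card[OF this, symmetric]
  have "card {E. T \<subseteq> E \<and> E \<subseteq> X \<and> card E = m} = card {E. E \<subseteq> X - T \<and> card E = m - card T}" .
  also have "\<dots> = card (X - T) choose (m - card T)"
    using assms by (intro n_subsets) auto
  finally show ?thesis using assms finT by (simp add: card_Diff_subset)
qed

text \<open>
  The union bound for a uniformly random \<open>m\<close>-subset \<open>E\<close> of \<open>X\<close>. A fixed \<open>t\<close>-set lies in \<open>E\<close> with
  probability \<open>(card X - t choose m - t) / (card X choose m) = (m choose t) / (card X choose t)\<close>, and
  \<open>E\<close> is bad if it contains one of the at most \<open>card J * (q choose t)\<close> many \<open>t\<close>-subsets of the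
  members of the family.
\<close>
lemma ex_subset_meeting_family_sparsely:
  assumes X: "finite X" and J: "finite J" and A: "\<And>j. j \<in> J \<Longrightarrow> A j \<subseteq> X \<and> card (A j) = q"
    and "t \<le> m" "m \<le> card X"
    and few: "card J * (q choose t) * (m choose t) < card X choose t"
  shows "\<exists>E. E \<subseteq> X \<and> card E = m \<and> (\<forall>j\<in>J. card (E \<inter> A j) < t)"
proof -
  define All where "All = {E. E \<subseteq> X \<and> card E = m}"
  define Sup where "Sup T = {E. T \<subseteq> E \<and> E \<subseteq> X \<and> card E = m}" for T
  define Sub where "Sub j = {T. T \<subseteq> A j \<and> card T = t}" for j
  define Bad where "Bad = (\<Union>j\<in>J. \<Union>T\<in>Sub j. Sup T)"
  have finA: "finite (A j)" if "j \<in> J" for j using that A X finite_subset by blast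
  have card_Sub: "card (Sub j) = q choose t" if "j \<in> J" for j
    using that A finA by (simp add: Sub_def n_subsets)
  have card_Sup: "card (Sup T) = (card X - t) choose (m - t)" if "j \<in> J" "T \<in> Sub j" for j T
  proof -
    have "T \<subseteq> X" "card T = t" using that(2) A[OF that(1)] by (auto simp: Sub_def)
    with card_supersets[OF X, of T m] \<open>t \<le> m\<close> show ?thesis by (simp add: Sup_def)
  qed
  have "card (\<Union>T\<in>Sub j. Sup T) \<le> (q choose t) * ((card X - t) choose (m - t))" if "j \<in> J" for j
  proof -
    have "card (\<Union>T\<in>Sub j. Sup T) \<le> (\<Sum>T\<in>Sub j. card (Sup T))"
      using finA[OF that] by (intro card_UN_le) (simp add: Sub_def)
    also have "\<dots> = (q choose t) * ((card X - t) choose (m - t))"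
      using card_Sup[OF that] card_Sub[OF that] by simp
    finally show ?thesis .
  qed
  then have "(\<Sum>j\<in>J. card (\<Union>T\<in>Sub j. Sup T)) \<le> card J * ((q choose t) * ((card X - t) choose (m - t)))"
    using sum_bounded_above[of J "\<lambda>j. card (\<Union>T\<in>Sub j. Sup T)"] by simp
  then have "card Bad \<le> card J * ((q choose t) * ((card X - t) choose (m - t)))"
    unfolding Bad_def using card_UN_le[OF J, of "\<lambda>j. \<Union>T\<in>Sub j. Sup T"] by linarith
  from mult_le_mono1[OF this, of "card X choose t"]
  have "card Bad * (card X choose t)
      \<le> card J * (q choose t) * ((card X choose t) * ((card X - t) choose (m - t)))"
    by (simp only: mult_ac)
  also have "(card X choose t) * ((card X - t) choose (m - t)) = (m choose t) * (card X choose m)"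
    using choose_mult[OF \<open>t \<le> m\<close> \<open>m \<le> card X\<close>] by (simp only: mult.commute)
  also have "card J * (q choose t) * \<dots> = card J * (q choose t) * (m choose t) * (card X choose m)"
    by (simp only: mult.assoc)
  also have "\<dots> < (card X choose t) * (card X choose m)"
    using few \<open>m \<le> card X\<close> by (intro mult_strict_right_mono) auto
  also have "card X choose m = card All"
    using X by (simp add: All_def n_subsets)
  finally have "card Bad < card All"
    by (simp add: mult.commute)
  moreover have "finite Bad"
    unfolding Bad_def Sup_def using X J finA by (auto simp: Sub_def)
  ultimately have "\<not> All \<subseteq> Bad"
    using card_mono by (metis not_le)
  then obtain E where E: "E \<in> All" "E \<notin> Bad" by blast
  have "card (E \<inter> A j) < t" if j: "j \<in> J" for j
  proof (rule ccontr)
    assume "\<not> card (E \<inter> A j) < t"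
    then obtain T where "T \<subseteq> E \<inter> A j" "card T = t"
      by (meson not_less obtain_subset_with_card_n)
    then have "T \<in> Sub j" "E \<in> Sup T" using E(1) by (auto simp: Sub_def Sup_def All_def)
    then show False using E(2) j by (auto simp: Bad_def)
  qed
  then show ?thesis using E(1) by (auto simp: All_def)
qed

text \<open>The term \<open>k\<^sup>k / k!\<close> is one summand of the exponential series at \<open>k\<close>, and \<open>exp 1 \<le> 3\<close>.\<close>
lemma power_self_le_fact: "k ^ k \<le> 3 ^ k * fact k"
proof -
  have "real k ^ k / fact k \<le> exp (real k)"
    using sum_le_suminf[OF summable_exp_generic[of "real k"], of "{k}"]
    by (simp add: exp_def divide_inverse mult.commute)
  also have "exp (real k) = exp 1 ^ k"
    by (simp flip: exp_of_nat_mult)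
  also have "\<dots> \<le> 3 ^ k"
    using exp_le by (intro power_mono) auto
  finally have "real k ^ k \<le> 3 ^ k * fact k"
    by (simp add: field_simps)
  then have "real (k ^ k) \<le> real (3 ^ k * fact k)" by simp
  then show ?thesis by (simp only: of_nat_le_iff)
qed

lemma binomial_mult_le_power: "(b * k) choose k \<le> (3 * b) ^ k"
proof -
  have "((b * k) choose k) * fact k \<le> b ^ k * k ^ k"
    using binomial_fact_pow[of "b * k" k] by (simp add: power_mult_distrib)
  also have "\<dots> \<le> b ^ k * (3 ^ k * fact k)"
    using power_self_le_fact by simp
  also have "\<dots> = (3 * b) ^ k * fact k"
    by (simp add: power_mult_distrib)
  finally show ?thesis by simp
qed

text \<open>
  The quotient of the two binomial coefficients is a product of factors \<open>(q - i) / (M - i)\<close>, none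
  of which exceeds \<open>q / M\<close>.
\<close>
lemma binomial_ratio_le:
  assumes "q \<le> M"
  shows "(q choose t) * M ^ t \<le> (M choose t) * q ^ t"
proof (induction t)
  case (Suc t)
  have step: "Suc t * ((n choose Suc t) * k ^ Suc t) = ((n - t) * k) * ((n choose t) * k ^ t)" for n k :: nat
  proof -
    have "Suc t * (n choose Suc t) = (n - t) * (n choose t)"
      by (simp only: binomial_absorption binomial_absorb_comp)
    then have "(Suc t * (n choose Suc t)) * k ^ Suc t = ((n - t) * (n choose t)) * k ^ Suc t"
      by (rule arg_cong)
    then show ?thesis by (simp only: power_Suc mult_ac)
  qed
  have "(q - t) * M \<le> (M - t) * q"
  proof -
    have "q * M - t * M \<le> q * M - t * q"
      using assms by (intro diff_le_mono2 mult_le_mono2)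
    then show ?thesis by (simp add: diff_mult_distrib mult.commute[of M])
  qed
  then have "((q - t) * M) * ((q choose t) * M ^ t) \<le> ((M - t) * q) * ((M choose t) * q ^ t)"
    using Suc.IH by (rule mult_le_mono)
  then have "Suc t * ((q choose Suc t) * M ^ Suc t) \<le> Suc t * ((M choose Suc t) * q ^ Suc t)"
    unfolding step .
  then show ?case by (simp del: mult_Suc)
qed auto

section \<open>The host graph\<close>

text \<open>
  The number of edges is \<open>r\<close> times \<open>24 r\<close> times the strict bound \<open>s n\<close> on the number of edges spanned
  by small sets, which is just enough to exceed what \<open>r\<close> colour classes without a path can
  carry. The condition \<open>n \<ge> s\<close> ensures that the complete graph has that many edges.
\<close>
lemma ex_locally_sparse_graph:
  fixes r n s :: nat
  assumes r: "r > 0" and s: "(36 * r) ^ 2 < 2 ^ s" and n: "n \<ge> s" "n > 0"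
  shows "\<exists>E. (\<forall>e\<in>E. e \<subseteq> {..<24 * r * n} \<and> card e = 2) \<and> card E = r * (24 * r) * (s * n) \<and>
           (\<forall>W. W \<subseteq> {..<24 * r * n} \<longrightarrow> card W \<le> 2 * n \<longrightarrow> card {e \<in> E. e \<subseteq> W} < s * n)"
proof -
  define N where "N = 24 * r * n"
  define m where "m = r * (24 * r) * (s * n)"
  define t where "t = s * n"
  define X where "X = {e. e \<subseteq> {..<N} \<and> card e = 2}"
  define J where "J = {W. W \<subseteq> {..<N} \<and> card W = 2 * n}"
  define q where "q = (2 * n) choose 2"
  define M where "M = N choose 2"
  have X: "finite X" "card X = M"
    by (auto simp: X_def M_def n_subsets)
  have J: "finite J" "card J \<le> (36 * r) ^ (2 * n)"
    using binomial_mult_le_power[of "12 * r" "2 * n"] by (auto simp: J_def n_subsets N_def mult_ac)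
  have q_eq: "q = n * (2 * n - 1)"
    by (simp add: q_def choose_two)
  have M_eq: "M = 12 * r * n * (24 * r * n - 1)"
    by (simp add: M_def N_def choose_two)
  \<comment> \<open>\<open>q\<close> and \<open>M\<close> count the pairs inside a \<open>2 n\<close>-set and among all vertices; their ratio is at most
    the square of \<open>2 / (24 r)\<close>.\<close>
  have qM: "q * (24 * r) ^ 2 \<le> 4 * M"
  proof -
    have "12 * r * (2 * n - 1) \<le> 24 * r * n - 1"
      using r by (simp add: diff_mult_distrib2)
    then have "48 * r * n * (12 * r * (2 * n - 1)) \<le> 48 * r * n * (24 * r * n - 1)"
      by (rule mult_le_mono2)
    then show ?thesis by (simp add: q_eq M_eq power2_eq_square mult_ac)
  qed
  have "s > 0" using s r by (cases s) auto
  have "m \<le> M"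
  proof -
    have "2 * (r * s) \<le> 2 * (r * n)" "r * n > 0" using n r by auto
    then have "2 * (r * s) \<le> 24 * (r * n) - 1" by linarith
    then have "12 * r * n * (2 * (r * s)) \<le> 12 * r * n * (24 * (r * n) - 1)"
      by (rule mult_le_mono2)
    then show ?thesis by (simp add: m_def M_eq mult_ac)
  qed
  have "q \<le> M"
    unfolding q_def M_def N_def using r by (intro binomial_right_mono) auto
  have "m > 0" using r n \<open>s > 0\<close> by (simp add: m_def)
  then have "M > 0" using \<open>m \<le> M\<close> by simp
  have "t \<le> m" using r by (simp add: t_def m_def)
  have mt: "m choose t \<le> (72 * r ^ 2) ^ t"
    using binomial_mult_le_power[of "24 * r ^ 2" t]
    by (simp add: m_def t_def power2_eq_square mult_ac)
  \<comment> \<open>The choice of \<open>24 r n\<close> vertices enters here: \<open>2 * 72 * r\<^sup>2 * q \<le> M\<close>.\<close>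
  have half: "2 ^ t * ((q choose t) * (m choose t)) \<le> M choose t"
  proof -
    have "2 ^ t * ((q choose t) * (m choose t)) * M ^ t = (2 ^ t * (m choose t)) * ((q choose t) * M ^ t)"
      by simp
    also have "\<dots> \<le> (2 ^ t * (72 * r ^ 2) ^ t) * ((M choose t) * q ^ t)"
      by (rule mult_le_mono[OF mult_le_mono2[OF mt] binomial_ratio_le[OF \<open>q \<le> M\<close>]])
    also have "\<dots> = (M choose t) * (144 * r ^ 2 * q) ^ t"
    proof -
      have "144 * r ^ 2 * q = 2 * (72 * r ^ 2) * q" by simp
      then have "(144 * r ^ 2 * q) ^ t = 2 ^ t * (72 * r ^ 2) ^ t * q ^ t"
        by (simp only: power_mult_distrib)
      then show ?thesis by (simp only: mult_ac)
    qed
    also have "\<dots> \<le> (M choose t) * M ^ t"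
      using qM by (intro mult_le_mono power_mono) (auto simp: power2_eq_square mult_ac)
    finally show ?thesis using \<open>M > 0\<close> by simp
  qed
  have "card J < 2 ^ t"
  proof -
    have "card J \<le> ((36 * r) ^ 2) ^ n" using J by (simp add: power_mult)
    also have "\<dots> < (2 ^ s) ^ n" using s n by (intro power_strict_mono) auto
    finally show ?thesis by (simp add: t_def power_mult)
  qed
  have "\<exists>E. E \<subseteq> X \<and> card E = m \<and> (\<forall>W\<in>J. card (E \<inter> {e. e \<subseteq> W \<and> card e = 2}) < t)"
  proof (rule ex_subset_meeting_family_sparsely)
    show "{e. e \<subseteq> W \<and> card e = 2} \<subseteq> X \<and> card {e. e \<subseteq> W \<and> card e = 2} = q" if "W \<in> J" for W
      using that finite_subset[of W "{..<N}"] by (auto simp: J_def X_def q_def n_subsets)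
    show "t \<le> m" by fact
    \<comment> \<open>When \<open>t\<close> exceeds the number of pairs in a \<open>2 n\<close>-set, the left side vanishes and the strict
      inequality comes from \<open>t \<le> M\<close> instead.\<close>
    show "card J * (q choose t) * (m choose t) < card X choose t"
    proof (cases "(q choose t) * (m choose t) = 0")
      case True
      then have "card J * (q choose t) * (m choose t) = 0" by auto
      moreover have "0 < card X choose t" using \<open>t \<le> m\<close> \<open>m \<le> M\<close> X by simp
      ultimately show ?thesis by linarith
    next
      case False
      then have "card J * ((q choose t) * (m choose t)) < 2 ^ t * ((q choose t) * (m choose t))"
        using \<open>card J < 2 ^ t\<close> by (intro mult_strict_right_mono) auto
      also have "\<dots> \<le> card X choose t" using half unfolding X .
      finally show ?thesis by (simp only: mult.assoc)
    qed
  qed (use X J \<open>m \<le> M\<close> in auto)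
  then obtain E where E: "E \<subseteq> X" "card E = m"
    and sparse: "\<And>W. W \<in> J \<Longrightarrow> card (E \<inter> {e. e \<subseteq> W \<and> card e = 2}) < t"
    by blast
  have finE: "finite E" using E X finite_subset by blast
  \<comment> \<open>The union bound only ran over sets of size exactly \<open>2 n\<close>; smaller sets extend to such a set.\<close>
  have "card {e \<in> E. e \<subseteq> W} < t" if W: "W \<subseteq> {..<N}" "card W \<le> 2 * n" for W
  proof -
    have "2 * n \<le> N" using r by (simp add: N_def)
    then obtain W' where W': "W \<subseteq> W'" "W' \<subseteq> {..<N}" "card W' = 2 * n"
      using exists_subset_between[of W "2 * n" "{..<N}"] W by auto
    have "card {e \<in> E. e \<subseteq> W} \<le> card (E \<inter> {e. e \<subseteq> W' \<and> card e = 2})"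
      using W' E finE by (intro card_mono) (auto simp: X_def)
    also have "\<dots> < t" using W' by (intro sparse) (auto simp: J_def)
    finally show ?thesis .
  qed
  then show ?thesis
    using E unfolding X_def N_def m_def t_def by (intro exI[of _ E]) auto
qed

section \<open>Size Ramsey numbers of paths\<close>

lemma contains_copy_path_if_successively:
  assumes "distinct xs" "set xs \<subseteq> gverts G" "successively (\<lambda>u v. {u, v} \<in> gedges G) xs" "n \<le> length xs"
  shows "contains_copy G (path_graph n)"
  unfolding contains_copy_def
proof (intro exI[of _ "\<lambda>i. xs ! i"] conjI ballI)
  show "inj_on ((!) xs) (gverts (path_graph n))"
    using assms by (auto simp: path_graph_def inj_on_def nth_eq_iff_index_eq)
  show "(!) xs ` gverts (path_graph n) \<subseteq> gverts G"
    using assms by (auto simp: path_graph_def)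
  show "(!) xs ` e \<in> gedges G" if "e \<in> gedges (path_graph n)" for e
    using that assms by (auto simp: path_graph_def successively_conv_nth)
qed

lemma size_ramsey_le:
  fixes G :: "nat graph"
  assumes "simple_graph G" "ramsey_arrow G H r"
  shows "size_ramsey H r \<le> card (gedges G)"
  unfolding size_ramsey_def using assms by (intro Least_le) blast

lemma ramsey_arrow_path_if_locally_sparse:
  fixes G :: "'a graph"
  assumes G: "simple_graph G" and V: "card (gverts G) = b * n"
    and m: "r * (b * K) < card (gedges G)"
    and sparse: "\<And>W. W \<subseteq> gverts G \<Longrightarrow> card W \<le> 2 * n \<Longrightarrow> card {e \<in> gedges G. e \<subseteq> W} \<le> K"
  shows "ramsey_arrow G (path_graph n) r"
  unfolding ramsey_arrow_def
proof (intro allI impI, rule ccontr)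
  fix c assume c: "c \<in> gedges G \<rightarrow> {..<r}"
    and no_copy: "\<not> (\<exists>i<r. contains_copy (color_class G c i) (path_graph n))"
  have fin: "finite (gverts G)" "finite (gedges G)"
    using G finite_subset[of "gedges G" "Pow (gverts G)"] by (auto simp: simple_graph_def)
  have "card (gedges (color_class G c i)) \<le> b * K" if "i < r" for i
  proof (rule card_edges_le_if_no_path[OF fin(1) V])
    show "e \<subseteq> gverts G \<and> card e = 2" if "e \<in> gedges (color_class G c i)" for e
      using that G by (auto simp: color_class_def simple_graph_def)
    show "length xs < n"
      if "distinct xs" "set xs \<subseteq> gverts G"
        "successively (\<lambda>u v. {u, v} \<in> gedges (color_class G c i)) xs" for xs
      using contains_copy_path_if_successively[of xs "color_class G c i" n] that no_copy \<open>i < r\<close>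
      by (force simp: color_class_def)
    show "card {e \<in> gedges (color_class G c i). e \<subseteq> W} \<le> K"
      if "W \<subseteq> gverts G" "card W \<le> 2 * n" for W
    proof -
      have "card {e \<in> gedges (color_class G c i). e \<subseteq> W} \<le> card {e \<in> gedges G. e \<subseteq> W}"
        using fin by (intro card_mono) (auto simp: color_class_def)
      with sparse[OF that] show ?thesis by simp
    qed
  qed
  then have "(\<Sum>i<r. card (gedges (color_class G c i))) \<le> r * (b * K)"
    using sum_bounded_above[of "{..<r}" "\<lambda>i. card (gedges (color_class G c i))" "b * K"] by simp
  moreover have "gedges G = (\<Union>i<r. gedges (color_class G c i))"
    using c by (auto simp: color_class_def)
  then have "card (gedges G) \<le> (\<Sum>i<r. card (gedges (color_class G c i)))"
    by (metis card_UN_le finite_lessThan)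
  ultimately show False using m by simp
qed

lemma size_ramsey_path_le:
  fixes r n s :: nat
  assumes r: "r > 0" and s: "(36 * r) ^ 2 < 2 ^ s" and n: "n \<ge> s" "n > 0"
  shows "size_ramsey (path_graph n) r \<le> 24 * r ^ 2 * s * n"
proof -
  obtain E where E: "\<And>e. e \<in> E \<Longrightarrow> e \<subseteq> {..<24 * r * n} \<and> card e = 2"
    and card_E: "card E = r * (24 * r) * (s * n)"
    and sparse: "\<And>W. W \<subseteq> {..<24 * r * n} \<Longrightarrow> card W \<le> 2 * n \<Longrightarrow> card {e \<in> E. e \<subseteq> W} < s * n"
    using ex_locally_sparse_graph[OF assms] by blast
  define G :: "nat graph" where "G = ({..<24 * r * n}, E)"
  have G: "simple_graph G" using E by (auto simp: G_def simple_graph_def)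
  have "s > 0" using s r by (cases s) auto
  have "ramsey_arrow G (path_graph n) r"
  proof (rule ramsey_arrow_path_if_locally_sparse[OF G])
    show "card (gverts G) = 24 * r * n" by (simp add: G_def)
    have "s * n - 1 < s * n" using \<open>s > 0\<close> n by simp
    then show "r * (24 * r * (s * n - 1)) < card (gedges G)"
      using r by (simp add: G_def card_E)
    show "card {e \<in> gedges G. e \<subseteq> W} \<le> s * n - 1" if "W \<subseteq> gverts G" "card W \<le> 2 * n" for W
      using sparse[of W] that by (simp add: G_def)
  qed
  from size_ramsey_le[OF G this] show ?thesis
    by (simp add: G_def card_E power2_eq_square mult_ac)
qed

lemma size_ramsey_path_one_le: "size_ramsey (path_graph n) 1 \<le> n"
proof -
  have "contains_copy (color_class (path_graph n) c 0) (path_graph n)"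
    if "c \<in> gedges (path_graph n) \<rightarrow> {..<1}" for c
    using that unfolding contains_copy_def by (intro exI[of _ id]) (auto simp: color_class_def)
  then have "ramsey_arrow (path_graph n) (path_graph n) 1"
    by (auto simp: ramsey_arrow_def)
  then have "size_ramsey (path_graph n) 1 \<le> card (gedges (path_graph n))"
    using size_ramsey_le simple_graph_path_graph by blast
  also have "gedges (path_graph n) \<subseteq> (\<lambda>i. {i, Suc i}) ` {..<n}"
    by (auto simp: path_graph_def)
  then have "card (gedges (path_graph n)) \<le> card {..<n}"
    by (meson card_image_le card_mono finite_imageI finite_lessThan order_trans)
  finally show ?thesis by simp
qed

theorem theorem4:
  shows "\<exists>\<epsilon> :: nat \<Rightarrow> real. \<epsilon> \<longlonglongrightarrow> 0 \<and>
    (\<forall>r::nat. r > 0 \<longrightarrow> (\<exists>n0::nat. \<forall>n\<ge>n0.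
       real (size_ramsey (path_graph n) r) \<le> real r powr (2 + \<epsilon> r) * real n))"
proof -
  \<comment> \<open>\<open>\<epsilon>\<close> is chosen so that \<open>r powr \<epsilon> r = L r\<close> for \<open>r \<ge> 2\<close>, where \<open>L r\<close> bounds \<open>24 s\<close> for the least
    admissible \<open>s\<close>.\<close>
  define L where "L r = 24 * (2 + log 2 ((36 * real r) ^ 2))" for r
  define \<epsilon> where "\<epsilon> r = ln (L r) / ln (real r)" for r
  have lim: "\<epsilon> \<longlonglongrightarrow> 0"
    unfolding \<epsilon>_def L_def log_def by real_asymp
  have bound: "\<exists>n0::nat. \<forall>n\<ge>n0. real (size_ramsey (path_graph n) r) \<le> real r powr (2 + \<epsilon> r) * real n"
    if r: "r > 0" for r :: nat
  proof (cases "r = 1")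
    case True
    then show ?thesis using size_ramsey_path_one_le by auto
  next
    case False
    with r have r2: "real r \<ge> 2" by simp
    define x where "x = log 2 ((36 * real r) ^ 2)"
    define s where "s = nat \<lfloor>x\<rfloor> + 1"
    have "x \<ge> 0" unfolding x_def using r2 one_le_power[of "36 * real r" 2] by (subst zero_le_log_cancel_iff) auto
    then have sx: "x < real s" "real s \<le> x + 1" by (auto simp: s_def) linarith+
    have "(36 * real r) ^ 2 = 2 powr x" using r by (simp add: x_def)
    also have "\<dots> < 2 powr real s" using sx by simp
    finally have "real ((36 * r) ^ 2) < real (2 ^ s)" by (simp add: powr_realpow)
    then have s: "(36 * r) ^ 2 < 2 ^ s" by (simp only: of_nat_less_iff)
    have "L r > 0" using \<open>x \<ge> 0\<close> by (simp add: L_def x_def)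
    moreover have "ln (real r) > 0" using r2 by simp
    ultimately have "real r powr \<epsilon> r = L r"
      using r by (simp add: powr_def \<epsilon>_def)
    then have "real r powr (2 + \<epsilon> r) = real r ^ 2 * L r"
      using r by (simp add: powr_add)
    moreover have "real (size_ramsey (path_graph n) r) \<le> real r ^ 2 * L r * real n" if "n \<ge> s" for n
    proof -
      have "real (size_ramsey (path_graph n) r) \<le> real (24 * r ^ 2 * s * n)"
        using size_ramsey_path_le[OF r s that] that by (simp only: of_nat_le_iff) (simp add: s_def)
      also have "\<dots> = real r ^ 2 * (24 * real s) * real n" by simp
      also have "\<dots> \<le> real r ^ 2 * L r * real n"
        using sx by (intro mult_right_mono mult_left_mono) (auto simp: L_def x_def)
      finally show ?thesis .
    qed
    ultimately show ?thesis by auto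
  qed
  from lim bound show ?thesis by blast
qed

end
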